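(* Identify $O_q$ with the subalgebra $\langle \mathcal W_0,\mathcal W_1\rangle$ of $\mathcal O_q$ via the injective algebra homomorphism $\imath:O_q\to\mathcal O_q$, $W_0\mapsto\mathcal W_0$, $W_1\mapsto \mathcal W_1$. Then for the algebra $\mathcal O_q$, $$\mathcal Z^\vee(t)=\xi\,\mathcal{\tilde G}(S)\,B(t)\,\mathcal{\tilde G}(T),\qquad \xi=-q(q-q^{-1})(q^2-q^{-2})^{-4}.$$
   Context: $\mathbb F$ is a field; $q\in\mathbb F$ is nonzero and not a root of unity; $\mathbb N=\{0,1,2,\ldots\}$; $[n]_q=(q^n-q^{-n})/(q-q^{-1})$. Algebras are associative, unital, over $\mathbb F$. $[X,Y]=XY-YX$ and $[X,Y]_r=rXY-r^{-1}YX$ for nonzero $r \in \mathbb F$. The $q$-Onsager algebra $O_q$ has generators $W_0,W_1$ and relations $[W_0,[W_0,[W_0,W_1]_q]_{q^{-1}}]=(q^2-q^{-2})^2[W_1,W_0]$ and $[W_1,[W_1,[W_1,W_0]_q]_{q^{-1}}]=(q^2-q^{-2})^2[W_0,W_1]$. Elements of $O_q$: $B_\delta=q^{-2}W_1W_0-W_0W_1$; with $c=q/((q-q^{-1})(q^2-q^{-2}))$: $B_{\alpha_1}=W_1$, $B_{\delta+\alpha_1}=W_0-c[B_\delta,W_1]$, $B_{n\delta+\alpha_1}=B_{(n-2)\delta+\alpha_1}-c[B_\delta,B_{(n-1)\delta+\alpha_1}]$ for $n\ge 2$; and for $n\ge1$, $B_{n\delta}=q^{-2}B_{(n-1)\delta+\alpha_1}W_0-W_0B_{(n-1)\delta+\alpha_1}+(q^{-2}-1)\sum_{\ell=0}^{n-2}B_{\ell\delta+\alpha_1}B_{(n-\ell-2)\delta+\alpha_1}$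 (consistent with $B_\delta$ for $n=1$); $B_{0\delta}=q^{-2}-1$. Set $B(t)=\sum_{n\in\mathbb N}B_{n\delta}t^n$. The algebra $\mathcal O_q$ has generators $\mathcal W_{-k},\mathcal W_{k+1},\mathcal G_{k+1},\mathcal{\tilde G}_{k+1}$ ($k\in\mathbb N$) and the following relations for $k,\ell\in\mathbb N$, where $\rho=-(q^2-q^{-2})^2$: $[\mathcal W_0,\mathcal W_{k+1}]=[\mathcal W_{-k},\mathcal W_1]=(\mathcal{\tilde G}_{k+1}-\mathcal G_{k+1})/(q+q^{-1})$; $[\mathcal W_0,\mathcal G_{k+1}]_q=[\mathcal{\tilde G}_{k+1},\mathcal W_0]_q=\rho\mathcal W_{-k-1}-\rho\mathcal W_{k+1}$; $[\mathcal G_{k+1},\mathcal W_1]_q=[\mathcal W_1,\mathcal{\tilde G}_{k+1}]_q=\rho\mathcal W_{k+2}-\rho\mathcal W_{-k}$; $[\mathcal W_{-k},\mathcal W_{-\ell}]=0$; $[\mathcal W_{k+1},\mathcal W_{\ell+1}]=0$; $[\mathcal W_{-k},\mathcal W_{\ell+1}]+[\mathcal W_{k+1},\mathcal W_{-\ell}]=0$; $[\mathcal W_{-k},\mathcal G_{\ell+1}]+[\mathcal G_{k+1},\mathcal W_{-\ell}]=0$; $[\mathcal W_{-k},\mathcal{\tilde G}_{\ell+1}]+[\mathcal{\tilde G}_{k+1},\mathcal W_{-\ell}]=0$; $[\mathcal W_{k+1},\mathcal G_{\ell+1}]+[\mathcal G_{k+1},\mathcal W_{\ell+1}]=0$; $[\mathcal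 W_{k+1},\mathcal{\tilde G}_{\ell+1}]+[\mathcal{\tilde G}_{k+1},\mathcal W_{\ell+1}]=0$; $[\mathcal G_{k+1},\mathcal G_{\ell+1}]=0$; $[\mathcal{\tilde G}_{k+1},\mathcal{\tilde G}_{\ell+1}]=0$; $[\mathcal{\tilde G}_{k+1},\mathcal G_{\ell+1}]+[\mathcal G_{k+1},\mathcal{\tilde G}_{\ell+1}]=0$. Also $\mathcal G_0=\mathcal{\tilde G}_0=-(q-q^{-1})[2]_q^2$. Set $\mathcal W^-(t)=\sum_{n\in\mathbb N}\mathcal W_{-n}t^n$, $\mathcal W^+(t)=\sum_{n\in\mathbb N}\mathcal W_{n+1}t^n$, $\mathcal G(t)=\sum_{n\in\mathbb N}\mathcal G_nt^n$, $\mathcal{\tilde G}(t)=\sum_{n\in\mathbb N}\mathcal{\tilde G}_nt^n$. $S=\frac{q+q^{-1}}{q^{-1}t+qt^{-1}}$ and $T=\frac{q+q^{-1}}{qt+q^{-1}t^{-1}}$, viewed as power series $S=(q+q^{-1})\sum_{\ell\in\mathbb N}(-1)^\ell q^{-2\ell-1}t^{2\ell+1}$, $T=(q+q^{-1})\sum_{\ell\in\mathbb N}(-1)^\ell q^{2\ell+1}t^{2\ell+1}$. Define $\Psi(t)=t^{-1}ST\,\mathcal W^-(S)\mathcal W^+(T)+tST\,\mathcal W^+(S)\mathcal W^-(T)-q^2ST\,\mathcal W^-(S)\mathcal W^-(T)-q^{-2}ST\,\mathcal W^+(S)\mathcal W^+(T)+(q^2-q^{-2})^{-2}\mathcal G(S)\mathcal{\tilde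 G}(T)$ and $\mathcal Z^\vee(t)=[2]_q^{-2}\Psi(t)$. It is known from earlier work that $\imath$ exists and is injective. The identity is between formal power series in $t$ over $\mathcal O_q$. *)

theory Defs
  imports
    "HOL-Library.Poly_Mapping"
    "HOL-Computational_Algebra.Formal_Power_Series"
begin

section \<open>Algebras over a field and presentations\<close>

locale unital_algebra = vector_space scale
  for scale :: "'f::field \<Rightarrow> 'a::ring_1 \<Rightarrow> 'a" +
  assumes scale_mult_left: "scale c x * y = scale c (x * y)"
    and scale_mult_right: "x * scale c y = scale c (x * y)"

definition algebra_hom ::
    "('f::field \<Rightarrow> 'a::ring_1 \<Rightarrow> 'a) \<Rightarrow> ('f \<Rightarrow> 'b::ring_1 \<Rightarrow> 'b) \<Rightarrow> ('a \<Rightarrow> 'b) \<Rightarrow> bool" where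
  "algebra_hom scale1 scale2 f \<longleftrightarrow>
     Vector_Spaces.linear scale1 scale2 f \<and> f 1 = 1 \<and> (\<forall>x y. f (x * y) = f x * f y)"

text \<open>
  Words form a monoid under concatenation. It is written additively, because the convolution
  product of \<^typ>\<open>'w \<Rightarrow>\<^sub>0 'f\<close> is provided for additively written (not necessarily commutative)
  monoids \<open>'w\<close>. Hence \<open>'g word \<Rightarrow>\<^sub>0 'f\<close> with its library ring structure is the free unital
  associative \<open>'f\<close>-algebra on \<open>'g\<close>.
\<close>

datatype 'g word = Word (letters: "'g list")

instantiation word :: (type) monoid_add
begin

definition zero_word :: "'a word" where
  "0 = Word []"

definition plus_word :: "'a word \<Rightarrow> 'a word \<Rightarrow> 'a word" where
  "u + v = Word (letters u @ letters v)"

instance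
  by standard (simp_all add: zero_word_def plus_word_def)

end

type_synonym ('g, 'f) free_algebra = "'g word \<Rightarrow>\<^sub>0 'f"

definition free_gen :: "'g \<Rightarrow> ('g, 'f::field) free_algebra" where
  "free_gen x = Poly_Mapping.single (Word [x]) 1"

definition free_scale :: "'f::field \<Rightarrow> ('g, 'f) free_algebra \<Rightarrow> ('g, 'f) free_algebra" where
  "free_scale c p = Poly_Mapping.single 0 c * p"

text \<open>The canonical homomorphism from the free algebra on \<open>'g\<close> that sends each \<open>x\<close> to \<open>g x\<close>.\<close>

definition free_eval ::
    "('f::field \<Rightarrow> 'a::ring_1 \<Rightarrow> 'a) \<Rightarrow> ('g \<Rightarrow> 'a) \<Rightarrow> ('g, 'f) free_algebra \<Rightarrow> 'a" where
  "free_eval scale g p =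
     (\<Sum>w\<in>Poly_Mapping.keys p. scale (Poly_Mapping.lookup p w) (prod_list (map g (letters w))))"

definition two_sided_ideal :: "'a::ring_1 set \<Rightarrow> bool" where
  "two_sided_ideal I \<longleftrightarrow>
     0 \<in> I \<and> (\<forall>x\<in>I. \<forall>y\<in>I. x + y \<in> I) \<and> (\<forall>x\<in>I. \<forall>a. a * x \<in> I \<and> x * a \<in> I)"

text \<open>
  The algebra \<open>'a\<close> is generated by the elements \<open>g x\<close>, with defining relations \<open>r = 0\<close> for
  \<open>r \<in> R\<close>: the canonical map from the free algebra is onto, and its kernel is the two-sided ideal
  generated by \<open>R\<close>.
\<close>

definition has_presentation ::
    "('f::field \<Rightarrow> 'a::ring_1 \<Rightarrow> 'a) \<Rightarrow> ('g \<Rightarrow> 'a) \<Rightarrow> ('g, 'f) free_algebra set \<Rightarrow> bool" where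
  "has_presentation scale g R \<longleftrightarrow>
     unital_algebra scale \<and> surj (free_eval scale g) \<and>
     {p. free_eval scale g p = 0} = two_sided_ideal hull R"

section \<open>Brackets and \<open>q\<close>-integers\<close>

definition comm :: "'a::ring_1 \<Rightarrow> 'a \<Rightarrow> 'a" where
  "comm x y = x * y - y * x"

definition qcomm :: "('f::field \<Rightarrow> 'a::ring_1 \<Rightarrow> 'a) \<Rightarrow> 'f \<Rightarrow> 'a \<Rightarrow> 'a \<Rightarrow> 'a" where
  "qcomm scale r x y = scale r (x * y) - scale (inverse r) (y * x)"

definition qnum :: "'f::field \<Rightarrow> nat \<Rightarrow> 'f" where
  "qnum q n = (q ^ n - q powi (- int n)) / (q - inverse q)"

section \<open>The \<open>q\<close>-Onsager algebra\<close>

datatype onsager_gen = W0 | W1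

definition onsager_relators :: "'f::field \<Rightarrow> (onsager_gen, 'f) free_algebra set" where
  "onsager_relators q =
    (let sc = free_scale; w0 = free_gen W0; w1 = free_gen W1; k = (q ^ 2 - q powi (-2)) ^ 2 in
      {comm w0 (qcomm sc (inverse q) w0 (qcomm sc q w0 w1)) - sc k (comm w1 w0),
       comm w1 (qcomm sc (inverse q) w1 (qcomm sc q w1 w0)) - sc k (comm w0 w1)})"

context
  fixes scale :: "'f::field \<Rightarrow> 'a::ring_1 \<Rightarrow> 'a" and q :: 'f and w0 w1 :: 'a
begin

definition B_delta1 :: 'a where
  "B_delta1 = scale (q powi (-2)) (w1 * w0) - w0 * w1"

definition B_coeff :: 'f where
  "B_coeff = q / ((q - inverse q) * (q ^ 2 - q powi (-2)))"

text \<open>\<open>B_alpha1 n\<close> is $B_{n\delta+\alpha_1}$ and \<open>B_delta n\<close> is $B_{n\delta}$.\<close>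

fun B_alpha1 :: "nat \<Rightarrow> 'a" where
  "B_alpha1 0 = w1"
| "B_alpha1 (Suc 0) = w0 - scale B_coeff (comm B_delta1 w1)"
| "B_alpha1 (Suc (Suc n)) = B_alpha1 n - scale B_coeff (comm B_delta1 (B_alpha1 (Suc n)))"

definition B_delta :: "nat \<Rightarrow> 'a" where
  "B_delta n =
    (if n = 0 then scale (q powi (-2) - 1) 1
     else scale (q powi (-2)) (B_alpha1 (n - 1) * w0) - w0 * B_alpha1 (n - 1)
        + scale (q powi (-2) - 1) (\<Sum>l<n - 1. B_alpha1 l * B_alpha1 (n - l - 2)))"

definition B_series :: "'a fps" where
  "B_series = Abs_fps B_delta"

end

section \<open>The alternating central extension\<close>

text \<open>
  \<open>Wminus k\<close>, \<open>Wplus k\<close>, \<open>Gpl k\<close>, \<open>Gti k\<close> stand for the generators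
  $\mathcal W_{-k}$, $\mathcal W_{k+1}$, $\mathcal G_{k+1}$, $\mathcal{\tilde G}_{k+1}$.
\<close>

datatype alt_gen = Wminus nat | Wplus nat | Gpl nat | Gti nat

definition alt_relators :: "'f::field \<Rightarrow> (alt_gen, 'f) free_algebra set" where
  "alt_relators q =
    (let sc = free_scale;
         Wm = (\<lambda>k. free_gen (Wminus k)); Wp = (\<lambda>k. free_gen (Wplus k));
         G = (\<lambda>k. free_gen (Gpl k)); Gt = (\<lambda>k. free_gen (Gti k));
         \<rho> = - ((q ^ 2 - q powi (-2)) ^ 2)
     in
      (\<Union>k. {comm (Wm 0) (Wp k) - sc (inverse (q + inverse q)) (Gt k - G k),
            comm (Wm k) (Wp 0) - sc (inverse (q + inverse q)) (Gt k - G k),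
            qcomm sc q (Wm 0) (G k) - (sc \<rho> (Wm (k + 1)) - sc \<rho> (Wp k)),
            qcomm sc q (Gt k) (Wm 0) - (sc \<rho> (Wm (k + 1)) - sc \<rho> (Wp k)),
            qcomm sc q (G k) (Wp 0) - (sc \<rho> (Wp (k + 1)) - sc \<rho> (Wm k)),
            qcomm sc q (Wp 0) (Gt k) - (sc \<rho> (Wp (k + 1)) - sc \<rho> (Wm k))})
      \<union>
      (\<Union>k l. {comm (Wm k) (Wm l),
              comm (Wp k) (Wp l),
              comm (Wm k) (Wp l) + comm (Wp k) (Wm l),
              comm (Wm k) (G l) + comm (G k) (Wm l),
              comm (Wm k) (Gt l) + comm (Gt k) (Wm l),
              comm (Wp k) (G l) + comm (G k) (Wp l),
              comm (Wp k) (Gt l) + comm (Gt k) (Wp l),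
              comm (G k) (G l),
              comm (Gt k) (Gt l),
              comm (Gt k) (G l) + comm (G k) (Gt l)}))"

section \<open>Generating functions\<close>

text \<open>
  \<open>S_fps q\<close> and \<open>T_fps q\<close> are the expansions at $t = 0$ of
  $(q+q^{-1})/(q^{-1}t+qt^{-1})$ and $(q+q^{-1})/(qt+q^{-1}t^{-1})$. The index \<open>n\<close> below is
  $2\ell+1$.
\<close>

definition S_fps :: "'f::field \<Rightarrow> 'f fps" where
  "S_fps q = Abs_fps (\<lambda>n. if odd n then (q + inverse q) * ((-1) ^ (n div 2) * q powi (- int n)) else 0)"

definition T_fps :: "'f::field \<Rightarrow> 'f fps" where
  "T_fps q = Abs_fps (\<lambda>n. if odd n then (q + inverse q) * ((-1) ^ (n div 2) * q powi (int n)) else 0)"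

definition fps_map :: "('a \<Rightarrow> 'b) \<Rightarrow> 'a fps \<Rightarrow> 'b fps" where
  "fps_map f p = Abs_fps (\<lambda>n. f (fps_nth p n))"

context
  fixes scale :: "'f::field \<Rightarrow> 'a::ring_1 \<Rightarrow> 'a" and q :: 'f and X :: "alt_gen \<Rightarrow> 'a"
begin

text \<open>The image in \<open>'a[[t]]\<close> of a series with scalar coefficients.\<close>

definition scalar_fps :: "'f fps \<Rightarrow> 'a fps" where
  "scalar_fps = fps_map (\<lambda>c. scale c 1)"

definition Wminus_series :: "'a fps" where
  "Wminus_series = Abs_fps (\<lambda>n. X (Wminus n))"

definition Wplus_series :: "'a fps" where
  "Wplus_series = Abs_fps (\<lambda>n. X (Wplus n))"

definition G_zero :: 'a where
  "G_zero = scale (- ((q - inverse q) * (qnum q 2) ^ 2)) 1"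

definition G_series :: "'a fps" where
  "G_series = Abs_fps (\<lambda>n. case n of 0 \<Rightarrow> G_zero | Suc k \<Rightarrow> X (Gpl k))"

definition Gtilde_series :: "'a fps" where
  "Gtilde_series = Abs_fps (\<lambda>n. case n of 0 \<Rightarrow> G_zero | Suc k \<Rightarrow> X (Gti k))"

text \<open>Since \<open>S\<close> and \<open>T\<close> have no constant term, \<open>fps_shift 1 (S * T)\<close> is $t^{-1}ST$.\<close>

definition Psi :: "'a fps" where
  "Psi =
    (let S = S_fps q; T = T_fps q; S' = scalar_fps S; T' = scalar_fps T in
       scalar_fps (fps_shift 1 (S * T)) * (Wminus_series oo S') * (Wplus_series oo T')
     + scalar_fps (fps_X * S * T) * (Wplus_series oo S') * (Wminus_series oo T')
     - scalar_fps (fps_const (q ^ 2) * S * T) * (Wminus_series oo S') * (Wminus_series oo T')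
     - scalar_fps (fps_const (q powi (-2)) * S * T) * (Wplus_series oo S') * (Wplus_series oo T')
     + scalar_fps (fps_const ((q ^ 2 - q powi (-2)) powi (-2)))
         * (G_series oo S') * (Gtilde_series oo T'))"

definition Z_vee :: "'a fps" where
  "Z_vee = scalar_fps (fps_const ((qnum q 2) powi (-2))) * Psi"

end

end

theory Submission
  imports Defs
begin

text \<open>
  Put $B^+(t) = \sum_n B_{n\delta+\alpha_1} t^n$ and $c = -1/(q^2-q^{-2})$. Its recursion says that $B^+$ is the
  unique power series solution $H$ of
  $(1-t^2) H + \frac{q}{(q-q^{-1})(q^2-q^{-2})}\, t\, [B_\delta, H] = W_1 + t W_0$.
  Since $B_\delta$ commutes with every $\mathcal{\tilde G}_k$, and since $[q B_\delta, \cdot\,]$ maps $Y\mathcal W^-(Y)$ and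
  $Y\mathcal W^+(Y)$ to $[\mathcal W_0, \mathcal{\tilde G}(Y)]$ and $[\mathcal W_1, \mathcal{\tilde G}(Y)]$, the same kind of
  equation shows
  $c\, B^+ \mathcal{\tilde G}(T) = t^{-1} T (q^{-1} \mathcal W^+(T) - q t \mathcal W^-(T)) =: E$ and
  $c\, \mathcal{\tilde G}(S) B^+ = t^{-1} S (q \mathcal W^+(S) - q^{-1} t \mathcal W^-(S)) =: E'$.
  Now $B(t)$ is a quadratic expression in $B^+$ and $\mathcal W_0$, so $\mathcal{\tilde G}(S) B(t) \mathcal{\tilde G}(T)$ can
  be written with $E$ and $E'$. The cubic terms that remain are those of $\mathcal G(S) \mathcal{\tilde G}(T)$, by the
  associativity relation $E' \mathcal{\tilde G}(T) = \mathcal{\tilde G}(S) E$.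
\<close>

unbundle fps_syntax

section \<open>Evaluation of relators\<close>

text \<open>Reduces identities that are additive in each argument to single words of the free
  algebra.\<close>

lemma poly_mapping_single_induct:
  assumes "P 0" and "\<And>k c. P (Poly_Mapping.single k c)"
    and "\<And>a b. P a \<Longrightarrow> P b \<Longrightarrow> P (a + b)"
  shows "P p"
proof (induction p rule: update_induct)
  case const
  show ?case by (rule assms(1))
next
  case (update p k c)
  have "Poly_Mapping.update k c p = Poly_Mapping.single k c + p"
    using update.hyps
    by (intro poly_mapping_eqI)
      (auto simp: lookup_update lookup_add lookup_single when_def not_in_keys_iff_lookup_eq_zero)
  then show ?case using assms(2,3) update.IH by simp
qed

context unital_algebra
begin

text \<open>Words outside the support have coefficient 0, so one finite index set can serve several
  elements at once, as additivity requires.\<close>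

lemma free_eval_superset:
  assumes "finite A" "Poly_Mapping.keys p \<subseteq> A"
  shows "free_eval scale g p = (\<Sum>w\<in>A. scale (Poly_Mapping.lookup p w) (prod_list (map g (letters w))))"
  unfolding free_eval_def using assms
  by (intro sum.mono_neutral_left) (auto simp: not_in_keys_iff_lookup_eq_zero)

lemma free_eval_add: "free_eval scale g (a + b) = free_eval scale g a + free_eval scale g b"
proof -
  let ?A = "Poly_Mapping.keys a \<union> Poly_Mapping.keys b"
  have "free_eval scale g c = (\<Sum>w\<in>?A. scale (Poly_Mapping.lookup c w) (prod_list (map g (letters w))))"
    if "Poly_Mapping.keys c \<subseteq> ?A" for c
    using that by (intro free_eval_superset) auto
  from this[of a] this[of b] this[of "a + b"] keys_add[of a b] show ?thesis
    by (simp add: lookup_add scale_left_distrib sum.distrib)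
qed

lemma free_eval_zero: "free_eval scale g 0 = 0"
  by (simp add: free_eval_def)

lemma free_eval_diff: "free_eval scale g (a - b) = free_eval scale g a - free_eval scale g b"
  using free_eval_add[of g "a - b" b] by (simp add: algebra_simps)

lemma free_eval_single:
  "free_eval scale g (Poly_Mapping.single w c) = scale c (prod_list (map g (letters w)))"
  by (simp add: free_eval_def)

lemma free_eval_mult: "free_eval scale g (a * b) = free_eval scale g a * free_eval scale g b"
proof (induction a rule: poly_mapping_single_induct)
  case (2 k c)
  show ?case
    by (induction b rule: poly_mapping_single_induct)
      (simp_all add: free_eval_zero free_eval_single mult_single plus_word_def distrib_left
        free_eval_add scale_mult_left scale_mult_right)
qed (simp_all add: free_eval_zero free_eval_add distrib_right)

lemma free_eval_gen: "free_eval scale g (free_gen x) = g x"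
  by (simp add: free_gen_def free_eval_single)

lemma free_eval_scale: "free_eval scale g (free_scale c a) = scale c (free_eval scale g a)"
  by (simp add: free_scale_def free_eval_mult free_eval_single zero_word_def scale_mult_left)

lemmas free_eval_simps = free_eval_add free_eval_diff free_eval_mult free_eval_gen free_eval_scale

end

lemma has_presentation_relator:
  assumes "has_presentation scale g R" "r \<in> R"
  shows "free_eval scale g r = 0"
proof -
  have "r \<in> two_sided_ideal hull R" using assms(2) hull_subset by fast
  then show ?thesis using assms(1) unfolding has_presentation_def by blast
qed

section \<open>The factorization in an algebra with central scalars\<close>

text \<open>The scalars form an integral domain rather than a field, so that power series in
  \<open>t\<close> can take this role and \<open>t\<close>, \<open>S\<close>, \<open>T\<close> count
  as central scalars. Inverses therefore enter as explicit elements with product 1.\<close>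

locale central_module = module scale
  for scale :: "'r::idom \<Rightarrow> 'b::ring_1 \<Rightarrow> 'b" (infixr \<open>*s\<close> 75) +
  assumes scale_mult_left: "(c *s x) * y = c *s (x * y)"
    and scale_mult_right: "x * (c *s y) = c *s (x * y)"
begin

lemma comm_scale_right: "comm x (c *s y) = c *s comm x y"
  by (simp add: comm_def scale_mult_left scale_mult_right scale_right_diff_distrib)

lemma comm_diff_right: "comm x (y - z) = comm x y - comm x z"
  by (simp add: comm_def algebra_simps)

text \<open>
  Here \<open>wm\<close>, \<open>wp\<close>, \<open>g\<close>, \<open>b\<close> stand for $\mathcal W^-(Y)$, $\mathcal W^+(Y)$, $\mathcal{\tilde G}(Y)$, $B_\delta$,
  and \<open>q'\<close>, \<open>k'\<close>, \<open>a'\<close> for the inverses of \<open>q\<close>, \<open>k\<close>, \<open>a\<close>. With \<open>y = Y / t\<close>, both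
  \<open>Y = S\<close>, \<open>(p, r) = (q, q')\<close> and \<open>Y = T\<close>, \<open>(p, r) = (q', q)\<close> are covered.
\<close>

lemma alternating_combination:
  fixes p r t y k Y :: 'r
  assumes pr: "p * r = 1" and k: "k = p + r" and Y: "Y = t * y" and y: "y * (r * t\<^sup>2 + p) = k"
    and V0: "V0 = wm - Y *s wp" and V1: "V1 = wp - Y *s wm"
    and E: "E = y *s (p *s wp - (r * t) *s wm)"
  shows "E - t\<^sup>2 *s E = k *s (V1 + t *s V0)"
proof -
  \<comment> \<open>Replacing a lone \<open>k\<close> by \<open>y\<close> times (r t^2 + p) in k - k
    t Y and in k Y - k t, and then using k = p + r, makes the factor 1 - t^2 appear.\<close>
  have 1: "(1 - t\<^sup>2) * (y * p) = k * (1 - t * Y)"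
    using pr k Y y by algebra
  have 2: "(1 - t\<^sup>2) * (y * (r * t)) = k * (Y - t)"
    using pr k Y y by algebra
  have "E - t\<^sup>2 *s E = ((1 - t\<^sup>2) * (y * p)) *s wp - ((1 - t\<^sup>2) * (y * (r * t))) *s wm"
    unfolding E by (simp add: algebra_simps)
  also have "\<dots> = k *s (V1 + t *s V0)"
    unfolding 1 2 V0 V1 by (simp add: algebra_simps)
  finally show ?thesis .
qed

text \<open>The factor \<open>a'^2 * k'\<close> turns \<rho> into \<open>- k\<close>, so
  \<open>V0\<close> and \<open>V1\<close> convert E - t^2 E into q-commutators with
  \<open>g\<close>. The factor \<open>y\<close> of \<open>E\<close> together with \<open>t\<close>
  gives \<open>Y\<close>, which is what \<open>comm0\<close> and \<open>comm1\<close> need. Hence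
  only products of \<open>g\<close> with \<open>w0\<close> and \<open>w1\<close> remain.\<close>

lemma alternating_recursion:
  fixes p r q q' t y k k' a a' \<rho> Y :: 'r
  assumes pr: "p * r = 1" and kpr: "k = p + r" and Y: "Y = t * y" and y: "y * (r * t\<^sup>2 + p) = k"
    and k: "k * k' = 1" and a: "a * a' = 1" and \<rho>: "\<rho> = - ((k * a)\<^sup>2)"
    and V0: "q *s (g * w0) - q' *s (w0 * g) = \<rho> *s (wm - Y *s wp)"
    and V1: "q *s (w1 * g) - q' *s (g * w1) = \<rho> *s (wp - Y *s wm)"
    and comm0: "(q * Y) *s comm b wm = comm w0 g"
    and comm1: "(q * Y) *s comm b wp = comm w1 g"
    and E: "E = y *s (p *s wp - (r * t) *s wm)"
  shows "E - t\<^sup>2 *s E + (q * a'\<^sup>2 * k' * t) *s comm b E =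
    (a'\<^sup>2 * k') *s (p *s comm w1 g - (r * t) *s comm w0 g
      - (q *s (w1 * g) - q' *s (g * w1)) - t *s (q *s (g * w0) - q' *s (w0 * g)))"
proof -
  have 1: "(a'\<^sup>2 * k') * \<rho> = - k"
    using k a \<rho> by algebra
  have "E - t\<^sup>2 *s E = k *s ((wp - Y *s wm) + t *s (wm - Y *s wp))"
    using alternating_combination[OF pr kpr Y y refl refl E] .
  also have "\<dots> = - (((a'\<^sup>2 * k') * \<rho>) *s ((wp - Y *s wm) + t *s (wm - Y *s wp)))"
    unfolding 1 by simp
  also have "\<dots> = - ((a'\<^sup>2 * k') *s (\<rho> *s (wp - Y *s wm) + t *s (\<rho> *s (wm - Y *s wp))))"
    by (simp add: scale_right_distrib mult_ac)
  also have "\<dots> = - ((a'\<^sup>2 * k') *s ((q *s (w1 * g) - q' *s (g * w1))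
      + t *s (q *s (g * w0) - q' *s (w0 * g))))"
    unfolding V0 V1 ..
  finally have 2: "E - t\<^sup>2 *s E = \<dots>" .
  have "(q * a'\<^sup>2 * k' * t) *s comm b E
      = (a'\<^sup>2 * k') *s (p *s ((q * Y) *s comm b wp) - (r * t) *s ((q * Y) *s comm b wm))"
    unfolding E Y by (simp add: comm_scale_right comm_diff_right scale_right_diff_distrib mult_ac)
  then show ?thesis
    unfolding 2 comm0 comm1 by (simp add: scale_right_diff_distrib scale_right_distrib)
qed

text \<open>For (p, r) = (q', q) all terms with \<open>g\<close> on the left cancel, so
  \<open>g\<close> ends up as a right factor.\<close>

lemma alternating_recursion_T:
  fixes q q' t y k k' a a' \<rho> Y :: 'r
  assumes q: "q * q' = 1" and kq: "k = q + q'" and aq: "a = q - q'"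
    and Y: "Y = t * y" and y: "y * (q * t\<^sup>2 + q') = k"
    and k: "k * k' = 1" and a: "a * a' = 1" and \<rho>: "\<rho> = - ((k * a)\<^sup>2)"
    and V0: "q *s (g * w0) - q' *s (w0 * g) = \<rho> *s (wm - Y *s wp)"
    and V1: "q *s (w1 * g) - q' *s (g * w1) = \<rho> *s (wp - Y *s wm)"
    and comm0: "(q * Y) *s comm b wm = comm w0 g"
    and comm1: "(q * Y) *s comm b wp = comm w1 g"
    and E: "E = y *s (q' *s wp - (q * t) *s wm)"
  shows "E - t\<^sup>2 *s E + (q * a'\<^sup>2 * k' * t) *s comm b E = (- (k' * a')) *s ((w1 + t *s w0) * g)"
proof -
  have *: "q' * q = 1" "k = q' + q" using q kq by (simp_all add: mult.commute add.commute)
  have "q' *s comm w1 g - (q * t) *s comm w0 g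
      - (q *s (w1 * g) - q' *s (g * w1)) - t *s (q *s (g * w0) - q' *s (w0 * g))
      = (- a) *s ((w1 + t *s w0) * g)"
    unfolding aq by (simp add: comm_def algebra_simps scale_mult_left)
  moreover have "(a'\<^sup>2 * k') * (- a) = - (k' * a')"
    using a by algebra
  ultimately show ?thesis
    unfolding alternating_recursion[OF * Y y k a \<rho> V0 V1 comm0 comm1 E] by (simp only: scale_scale)
qed

text \<open>For (p, r) = (q, q') it is the terms with \<open>g\<close> on the right that cancel, so
  \<open>g\<close> ends up as a left factor.\<close>

lemma alternating_recursion_S:
  fixes q q' t y k k' a a' \<rho> Y :: 'r
  assumes q: "q * q' = 1" and kq: "k = q + q'" and aq: "a = q - q'"
    and Y: "Y = t * y" and y: "y * (q' * t\<^sup>2 + q) = k"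
    and k: "k * k' = 1" and a: "a * a' = 1" and \<rho>: "\<rho> = - ((k * a)\<^sup>2)"
    and V0: "q *s (g * w0) - q' *s (w0 * g) = \<rho> *s (wm - Y *s wp)"
    and V1: "q *s (w1 * g) - q' *s (g * w1) = \<rho> *s (wp - Y *s wm)"
    and comm0: "(q * Y) *s comm b wm = comm w0 g"
    and comm1: "(q * Y) *s comm b wp = comm w1 g"
    and E: "E = y *s (q *s wp - (q' * t) *s wm)"
  shows "E - t\<^sup>2 *s E + (q * a'\<^sup>2 * k' * t) *s comm b E = (- (k' * a')) *s (g * (w1 + t *s w0))"
proof -
  have "q *s comm w1 g - (q' * t) *s comm w0 g
      - (q *s (w1 * g) - q' *s (g * w1)) - t *s (q *s (g * w0) - q' *s (w0 * g))
      = (- a) *s (g * (w1 + t *s w0))"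
    unfolding aq by (simp add: comm_def algebra_simps scale_mult_right)
  moreover have "(a'\<^sup>2 * k') * (- a) = - (k' * a')"
    using a by algebra
  ultimately show ?thesis
    unfolding alternating_recursion[OF q kq Y y k a \<rho> V0 V1 comm0 comm1 E] by (simp only: scale_scale)
qed

text \<open>
  Here \<open>mS\<close>, \<open>pS\<close>, \<open>gS\<close>, \<open>GS\<close> stand for $\mathcal W^-(S)$, $\mathcal W^+(S)$, $\mathcal{\tilde G}(S)$, $\mathcal G(S)$
  (likewise for \<open>T\<close>), and \<open>BP\<close> for $B^+$.
\<close>

lemma factorization_core:
  fixes q q' t \<sigma> \<tau> S T k k' a a' \<rho> c :: 'r
  assumes q: "q * q' = 1" and kq: "k = q + q'" and aq: "a = q - q'"
    and k: "k * k' = 1" and a: "a * a' = 1" and \<rho>: "\<rho> = - ((k * a)\<^sup>2)" and c: "c = - (k' * a')"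
    and S: "S = t * \<sigma>" and \<sigma>: "\<sigma> * (q' * t\<^sup>2 + q) = k" and T: "T = t * \<tau>"
    and V0: "q *s (gS * w0) - q' *s (w0 * gS) = \<rho> *s (mS - S *s pS)"
    and w0mS: "comm w0 mS = 0"
    and GS: "GS = gS - (k * S) *s comm w0 pS"
    and E: "\<tau> *s (q' *s pT - (q * t) *s mT) = c *s (BP * gT)"
    and E': "\<sigma> *s (q *s pS - (q' * t) *s mS) = c *s (gS * BP)"
    and B: "B = (q'\<^sup>2 - 1) *s 1 + t *s (q'\<^sup>2 *s (BP * w0) - w0 * BP) + ((q'\<^sup>2 - 1) * t\<^sup>2) *s (BP * BP)"
  shows "k'\<^sup>2 *s ((\<sigma> * T) *s (mS * pT) + (t * S * T) *s (pS * mT) - (q\<^sup>2 * S * T) *s (mS * mT)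
      - (q'\<^sup>2 * S * T) *s (pS * pT) + (k' * a')\<^sup>2 *s (GS * gT))
    = (- q * a * (k' * a')^4) *s (gS * B * gT)"
proof -
  define E where "E = \<tau> *s (q' *s pT - (q * t) *s mT)"
  define E' where "E' = \<sigma> *s (q *s pS - (q' * t) *s mS)"
  define V where "V = mS - S *s pS"
  \<comment> \<open>After multiplication by c^2, each \<open>BP\<close> absorbs one \<open>c\<close>
    and the adjacent \<open>gS\<close> or \<open>gT\<close>, becoming \<open>E'\<close> or
    \<open>E\<close>. The part of \<open>B\<close> linear in \<open>BP\<close> then yields
    \<open>M\<close> up to the factor t c.\<close>
  define M where "M = q'\<^sup>2 *s (E' * w0 * gT) - gS * w0 * E"
  have cE: "c *s (BP * gT) = E" and cE': "c *s (gS * BP) = E'"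
    using E E' by (simp_all add: E_def E'_def)
  \<comment> \<open>Both sides are c times the product of \<open>gS\<close>, \<open>BP\<close> and
    \<open>gT\<close>, bracketed in two ways.\<close>
  have EE': "E' * gT = gS * E"
    unfolding cE[symmetric] cE'[symmetric] by (simp add: scale_mult_left scale_mult_right mult.assoc)
  have "c\<^sup>2 *s (gS * B * gT) = (c\<^sup>2 * (q'\<^sup>2 - 1)) *s (gS * gT)
      + (t * c) *s (q'\<^sup>2 *s ((c *s (gS * BP)) * w0 * gT) - gS * w0 * (c *s (BP * gT)))
      + ((q'\<^sup>2 - 1) * t\<^sup>2) *s ((c *s (gS * BP)) * (c *s (BP * gT)))"
    unfolding B
    by (simp add: algebra_simps scale_mult_left scale_mult_right power2_eq_square)
  then have gBg: "c\<^sup>2 *s (gS * B * gT) = (c\<^sup>2 * (q'\<^sup>2 - 1)) *s (gS * gT) + (t * c) *s M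
      + ((q'\<^sup>2 - 1) * t\<^sup>2) *s (E' * E)"
    unfolding cE cE' M_def .
  \<comment> \<open>As \<open>w0\<close> commutes with \<open>mS\<close>, only the \<open>pS\<close>
    term of \<open>E'\<close> survives; thus the commutator that separates \<open>GS\<close> from
    \<open>gS\<close> becomes one with \<open>E'\<close>.\<close>
  have w0E': "comm w0 E' = (\<sigma> * q) *s comm w0 pS"
    unfolding E'_def by (simp add: comm_scale_right comm_diff_right w0mS)
  have "(k * t * q') * (\<sigma> * q) = k * S" using q S by algebra
  then have GS': "GS = gS - (k * t * q') *s comm w0 E'"
    unfolding GS w0E' by (simp only: scale_scale)
  have "w0 * gS = q *s (q' *s (w0 * gS))" using q by simp
  also have "q' *s (w0 * gS) = q *s (gS * w0) - \<rho> *s V"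
    using V0 unfolding V_def by (simp add: algebra_simps)
  finally have w0gS: "w0 * gS = q\<^sup>2 *s (gS * w0) - (q * \<rho>) *s V"
    by (simp add: scale_right_diff_distrib power2_eq_square)
  \<comment> \<open>\<open>EE'\<close> moves \<open>E'\<close> away from \<open>w0\<close>, and
    \<open>w0gS\<close> then restores the order with \<open>gS\<close> first. This produces the two
    words of \<open>M\<close> and a correction in \<open>V * E\<close>.\<close>
  have "comm w0 E' * gT = w0 * gS * E - E' * w0 * gT"
    by (simp add: comm_def left_diff_distrib mult.assoc EE')
  also have "\<dots> = q\<^sup>2 *s (gS * w0 * E) - (q * \<rho>) *s (V * E) - E' * w0 * gT"
    unfolding w0gS by (simp add: left_diff_distrib scale_mult_left)
  finally have "GS * gT = gS * gT - (k * t * q') *s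
      (q\<^sup>2 *s (gS * w0 * E) - (q * \<rho>) *s (V * E) - E' * w0 * gT)"
    unfolding GS' by (simp add: left_diff_distrib scale_mult_left)
  also have "\<dots> = gS * gT - (k * t * q' * q\<^sup>2) *s (gS * w0 * E) + (k * t * (q' * q) * \<rho>) *s (V * E)
      + (k * t * q') *s (E' * w0 * gT)"
    by (simp add: scale_right_diff_distrib mult_ac)
  also have "k * t * q' * q\<^sup>2 = k * t * q" using q by algebra
  also have "k * t * (q' * q) * \<rho> = k * t * \<rho>" using q by algebra
  also have "k * t * q' = k * t * q * q'\<^sup>2" using q by algebra
  finally have GSgT: "GS * gT = gS * gT + (k * t * q) *s M + (k * t * \<rho>) *s (V * E)"
    unfolding M_def by (simp add: scale_right_diff_distrib algebra_simps)
  \<comment> \<open>This combination is the left factor of the four quadratic terms of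
    \<open>Psi\<close>: its product with \<open>t *s E\<close> gives all of them at once.\<close>
  have "k *s V + t *s E' = (k - q' * t * S) *s mS - (q' * S) *s pS"
    unfolding V_def E'_def kq S by (simp add: algebra_simps power2_eq_square)
  also have "k - q' * t * S = q * \<sigma>"
    unfolding S \<sigma>[symmetric] by (simp add: algebra_simps power2_eq_square)
  finally have kVE': "k *s V + t *s E' = (q * \<sigma>) *s mS - (q' * S) *s pS" .
  have "(k *s V + t *s E') * (t *s E) = (q * q' * \<sigma> * T) *s (mS * pT) + (q' * q * t * S * T) *s (pS * mT)
      - (q * q * (t * \<sigma>) * T) *s (mS * mT) - (q' * q' * S * T) *s (pS * pT)"
    unfolding kVE' E_def T
    by (simp add: algebra_simps scale_mult_left scale_mult_right)
  also have "q * q' * \<sigma> * T = \<sigma> * T" using q by algebra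
  also have "q' * q * t * S * T = t * S * T" using q by algebra
  also have "q * q * (t * \<sigma>) * T = q\<^sup>2 * S * T" using S by algebra
  also have "q' * q' * S * T = q'\<^sup>2 * S * T" by algebra
  finally have Psi4: "(\<sigma> * T) *s (mS * pT) + (t * S * T) *s (pS * mT) - (q\<^sup>2 * S * T) *s (mS * mT)
      - (q'\<^sup>2 * S * T) *s (pS * pT) = (k * t) *s (V * E) + t\<^sup>2 *s (E' * E)"
    by (simp add: algebra_simps scale_mult_left scale_mult_right power2_eq_square)
  \<comment> \<open>The \<open>V * E\<close> terms of \<open>Psi4\<close> and \<open>GSgT\<close>
    cancel because \<rho> times \<open>?u^2\<close> is -1. The three remaining coefficients are
    those of \<open>gBg\<close> multiplied by \<open>- q * a * ?u^2\<close>.\<close>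
  let ?u = "k' * a'"
  have "k'\<^sup>2 *s ((\<sigma> * T) *s (mS * pT) + (t * S * T) *s (pS * mT) - (q\<^sup>2 * S * T) *s (mS * mT)
      - (q'\<^sup>2 * S * T) *s (pS * pT) + ?u\<^sup>2 *s (GS * gT))
     = (k'\<^sup>2 * ?u\<^sup>2) *s (gS * gT) + (k'\<^sup>2 * ?u\<^sup>2 * (k * t * q)) *s M
       + (k'\<^sup>2 * (?u\<^sup>2 * (k * t * \<rho>) + k * t)) *s (V * E) + (k'\<^sup>2 * t\<^sup>2) *s (E' * E)"
    unfolding Psi4 GSgT by (simp add: algebra_simps)
  also have "k'\<^sup>2 * (?u\<^sup>2 * (k * t * \<rho>) + k * t) = 0"
    using k a \<rho> by algebra
  also have "k'\<^sup>2 * ?u\<^sup>2 = (- q * a * ?u\<^sup>2) * (c\<^sup>2 * (q'\<^sup>2 - 1))"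
    using k a c q aq by algebra
  also have "(- q * a * ?u\<^sup>2) * (c\<^sup>2 * (q'\<^sup>2 - 1)) * (k * t * q) = (- q * a * ?u\<^sup>2) * (t * c)"
    using k a c q aq by algebra
  also have "k'\<^sup>2 * t\<^sup>2 = (- q * a * ?u\<^sup>2) * ((q'\<^sup>2 - 1) * t\<^sup>2)"
    using k a c q aq by algebra
  finally have "k'\<^sup>2 *s ((\<sigma> * T) *s (mS * pT) + (t * S * T) *s (pS * mT) - (q\<^sup>2 * S * T) *s (mS * mT)
      - (q'\<^sup>2 * S * T) *s (pS * pT) + ?u\<^sup>2 *s (GS * gT)) = (- q * a * ?u\<^sup>2) *s (c\<^sup>2 *s (gS * B * gT))"
    unfolding gBg by (simp only: scale_right_distrib scale_scale scale_zero_left add_0_right)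
  also have "\<dots> = (- q * a * ?u\<^sup>2 * c\<^sup>2) *s (gS * B * gT)" by simp
  also have "- q * a * ?u\<^sup>2 * c\<^sup>2 = - q * a * ?u^4" using c by algebra
  finally show ?thesis .
qed

end

section \<open>Power series with scalar coefficients\<close>

text \<open>The exchange of q and its inverse swaps \<open>S\<close> and \<open>T\<close>, so the
  facts about \<open>T\<close> are instances of those about \<open>S\<close>.\<close>

lemma S_fps_inverse: "S_fps (inverse q) = T_fps q"
proof -
  have "inverse q powi (- int n) = q powi int n" for n
    by (simp add: power_int_minus power_inverse)
  then show ?thesis by (intro fps_ext) (simp add: S_fps_def T_fps_def add.commute)
qed

lemma S_fps_nth_0: "S_fps q $ 0 = 0"
  by (simp add: S_fps_def)

lemma S_fps_eq_X_mult_shift: "S_fps q = fps_X * fps_shift 1 (S_fps q)"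
  by (rule fps_ext) (simp add: S_fps_nth_0)

text \<open>This is the fraction defining \<open>S\<close> with its denominator cleared, in terms of
  \<open>S / t\<close>.\<close>

lemma S_fps_equation:
  assumes "q \<noteq> 0"
  shows "fps_shift 1 (S_fps q) * (fps_const (inverse q) * fps_X\<^sup>2 + fps_const q) = fps_const (q + inverse q)"
proof (rule fps_ext)
  fix n
  have "(fps_shift 1 (S_fps q) * (fps_const (inverse q) * fps_X\<^sup>2 + fps_const q)) $ n
    = inverse q * (if n < 2 then 0 else S_fps q $ (n - 1)) + q * S_fps q $ (n + 1)"
  proof -
    have "fps_shift 1 (S_fps q) * (fps_const (inverse q) * fps_X\<^sup>2 + fps_const q)
      = fps_const (inverse q) * (fps_X^2 * fps_shift 1 (S_fps q)) + fps_const q * fps_shift 1 (S_fps q)"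
      by (simp add: algebra_simps)
    then show ?thesis
      using Suc_diff_Suc[of 1 n] by (cases "n < 2") (auto simp: fps_X_power_mult_nth numeral_2_eq_2 simp del: power_Suc)
  qed
  \<comment> \<open>Only the leading coefficient of \<open>S\<close> contributes at n = 0. From n =
    2 on, the coefficients of index n - 1 and n + 1 differ by the factor - q^(-2), and the two terms
    cancel.\<close>
  also have "\<dots> = (if n = 0 then q + inverse q else 0)"
  proof (cases "n < 2")
    case True
    then have "n = 0 \<or> n = 1" by auto
    then show ?thesis using assms by (auto simp: S_fps_def power_int_minus field_simps)
  next
    case False
    then obtain m where n: "n = Suc (Suc m)" by (metis add_2_eq_Suc le_Suc_ex not_less)
    have "q powi (- 3 - int m) = q powi (- 1 - int m) * inverse q * inverse q"
      using assms power_int_add[of q "- 1 - int m" "- 2"]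
      by (simp add: power_int_minus power2_eq_square)
    then show ?thesis using assms by (auto simp: S_fps_def n)
  qed
  finally show "(fps_shift 1 (S_fps q) * (fps_const (inverse q) * fps_X\<^sup>2 + fps_const q)) $ n
    = fps_const (q + inverse q) $ n" by simp
qed

context unital_algebra
begin

abbreviation sc :: "'f fps \<Rightarrow> 'a fps" where "sc \<equiv> scalar_fps scale"

lemma scalar_fps_nth: "sc p $ n = scale (p $ n) 1"
  by (simp add: scalar_fps_def fps_map_def)

lemma scalar_fps_mult_nth: "(sc p * f) $ n = (\<Sum>i=0..n. scale (p $ i) (f $ (n - i)))"
  by (simp add: fps_mult_nth scalar_fps_nth scale_mult_left)

lemma scalar_fps_commute: "f * sc p = sc p * f"
proof (rule fps_ext)
  fix n
  have "(f * sc p) $ n = (\<Sum>i=0..n. scale (p $ (n - i)) (f $ i))"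
    by (simp add: fps_mult_nth scalar_fps_nth scale_mult_right)
  also have "\<dots> = (\<Sum>i=0..n. scale (p $ i) (f $ (n - i)))"
    by (rule sum.reindex_bij_witness[of _ "\<lambda>i. n - i" "\<lambda>i. n - i"]) auto
  finally show "(f * sc p) $ n = (sc p * f) $ n" by (simp add: scalar_fps_mult_nth)
qed

lemma scalar_fps_mult: "sc (p * r) = sc p * sc r"
  by (rule fps_ext)
    (simp add: scalar_fps_mult_nth scalar_fps_nth fps_mult_nth[of p r] scale_sum_left)

lemma scalar_fps_add: "sc (p + r) = sc p + sc r"
  by (rule fps_ext) (simp add: scalar_fps_nth scale_left_distrib)

lemma scalar_fps_const: "sc (fps_const c) = fps_const (scale c 1)"
  by (rule fps_ext) (simp add: scalar_fps_nth)

lemma scalar_fps_1: "sc 1 = 1"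
  by (rule fps_ext) (simp add: scalar_fps_nth)

lemma scalar_fps_X: "sc fps_X = fps_X"
  by (rule fps_ext) (simp add: scalar_fps_nth)

lemma scalar_fps_power: "sc (p ^ n) = sc p ^ n"
  by (induction n) (simp_all add: scalar_fps_1 scalar_fps_mult)

lemma scalar_fps_const_mult_nth: "(sc (fps_const c) * f) $ n = scale c (f $ n)"
  by (simp add: scalar_fps_const scale_mult_left)

text \<open>Scalar series are central even though the coefficient algebra is not commutative. This
  makes the purely algebraic identities above available for power series.\<close>

sublocale fps: central_module "\<lambda>p f. scalar_fps scale p * f"
proof unfold_locales
  fix p f g
  show "f * (sc p * g) = sc p * (f * g)"
    by (metis mult.assoc scalar_fps_commute)
qed (simp_all add: distrib_left distrib_right scalar_fps_add scalar_fps_mult scalar_fps_1 mult.assoc)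

end

lemma comm_0_right [simp]: "comm x 0 = 0"
  by (simp add: comm_def)

lemma fps_comm_const_nth: "comm (fps_const b) f $ n = comm b (f $ n)"
  by (simp add: comm_def)

text \<open>The difference D of two solutions satisfies D = t (t D - K [b, D]), so each coefficient
  of D is determined by earlier ones and vanishes by induction.\<close>

lemma fps_recursion_unique:
  fixes H H' R K :: "'b::ring_1 fps"
  assumes H: "H - fps_X\<^sup>2 * H + fps_X * (K * comm (fps_const b) H) = R"
    and H': "H' - fps_X\<^sup>2 * H' + fps_X * (K * comm (fps_const b) H') = R"
  shows "H = H'"
proof -
  define D where "D = H - H'"
  have "D - fps_X\<^sup>2 * D + fps_X * (K * comm (fps_const b) D)
    = (H - fps_X\<^sup>2 * H + fps_X * (K * comm (fps_const b) H))
      - (H' - fps_X\<^sup>2 * H' + fps_X * (K * comm (fps_const b) H'))"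
    by (simp add: D_def comm_def algebra_simps)
  also have "\<dots> = 0" unfolding H H' by simp
  finally have D: "D = fps_X * (fps_X * D - K * comm (fps_const b) D)"
    by (simp add: algebra_simps power2_eq_square)
  have "D $ n = 0" for n
  proof (induction n rule: less_induct)
    case (less n)
    show ?case
    proof (cases n)
      case 0
      then show ?thesis by (subst D) simp
    next
      case (Suc m)
      have "(K * comm (fps_const b) D) $ m = 0"
        using less Suc by (simp add: fps_mult_nth fps_comm_const_nth)
      moreover have "(fps_X * D) $ m = 0"
        using less Suc by simp
      ultimately show ?thesis using Suc by (subst D) simp
    qed
  qed
  then have "D = 0" by (intro fps_ext) simp
  then show ?thesis by (simp add: D_def)
qed

lemma pow_nth_eq_0:
  fixes Y :: "'r::comm_ring_1 fps"
  assumes "Y $ 0 = 0" "n < i"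
  shows "Y ^ i $ n = 0"
  using startsby_zero_power_prefix assms by blast

section \<open>Substitution of scalar series into series with noncommuting coefficients\<close>

context unital_algebra
begin

lemma compose_scalar_nth:
  "(f oo sc Y) $ n = (\<Sum>i=0..n. scale (Y ^ i $ n) (f $ i))"
  by (simp add: fps_compose_nth scalar_fps_nth scale_mult_right flip: scalar_fps_power)

text \<open>A bound \<open>N\<close> independent of \<open>n\<close> lets the sums in the Cauchy
  product with \<open>Y\<close> be interchanged.\<close>

lemma compose_scalar_nth_upto:
  assumes "Y $ 0 = 0" "n \<le> N"
  shows "(f oo sc Y) $ n = (\<Sum>i=0..N. scale (Y ^ i $ n) (f $ i))"
  unfolding compose_scalar_nth using assms
  by (intro sum.mono_neutral_left) (auto simp: pow_nth_eq_0)

lemma compose_scalar_const_left: "(fps_const b * f) oo sc Y = fps_const b * (f oo sc Y)"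
  by (rule fps_ext) (simp add: compose_scalar_nth sum_distrib_left scale_mult_right)

lemma compose_scalar_const_right: "(f * fps_const b) oo sc Y = (f oo sc Y) * fps_const b"
  by (rule fps_ext) (simp add: compose_scalar_nth sum_distrib_right scale_mult_left)

lemma compose_scalar_comm: "comm (fps_const b) f oo sc Y = comm (fps_const b) (f oo sc Y)"
  by (simp add: comm_def fps_compose_sub_distrib compose_scalar_const_left compose_scalar_const_right)

lemma compose_scalar_scale: "(sc (fps_const c) * f) oo sc Y = sc (fps_const c) * (f oo sc Y)"
  by (simp add: scalar_fps_const compose_scalar_const_left)

text \<open>Multiplication by \<open>Y\<close> raises each power Y^i to Y^(i+1), which is the index
  shift that \<open>fps_X\<close> causes. Linearity and this rule suffice to substitute into the
  relations.\<close>

lemma compose_scalar_X: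
  assumes Y: "Y $ 0 = 0"
  shows "(fps_X * f) oo sc Y = sc Y * (f oo sc Y)"
proof (rule fps_ext)
  fix n
  have "(sc Y * (f oo sc Y)) $ n = (\<Sum>j=0..n. scale (Y $ j) ((f oo sc Y) $ (n - j)))"
    by (rule scalar_fps_mult_nth)
  also have "\<dots> = (\<Sum>j=0..n. \<Sum>i=0..n. scale (Y $ j * Y ^ i $ (n - j)) (f $ i))"
    using Y by (intro sum.cong refl)
      (simp add: compose_scalar_nth_upto[of Y _ n] scale_sum_right)
  also have "\<dots> = (\<Sum>i=0..n. scale (Y ^ Suc i $ n) (f $ i))"
    by (subst sum.swap) (simp add: fps_mult_nth scale_sum_left)
  \<comment> \<open>The new term i = 0 vanishes, since \<open>fps_X * f\<close> has no constant
    term.\<close>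
  also have "\<dots> = (\<Sum>i=0..Suc n. scale (Y ^ i $ n) ((fps_X * f) $ i))"
    by (subst sum.atLeast0_atMost_Suc_shift) simp
  also have "\<dots> = ((fps_X * f) oo sc Y) $ n"
    using Y by (simp add: compose_scalar_nth_upto[of Y n "Suc n"])
  finally show "((fps_X * f) oo sc Y) $ n = (sc Y * (f oo sc Y)) $ n" by simp
qed

lemmas compose_scalar_simps = fps_compose_add_distrib fps_compose_sub_distrib
  compose_scalar_const_left compose_scalar_const_right compose_scalar_comm compose_scalar_scale

end

section \<open>The alternating central extension\<close>

locale alternating_extension =
  fixes scale :: "'f::field \<Rightarrow> 'a::ring_1 \<Rightarrow> 'a" and q :: 'f and X :: "alt_gen \<Rightarrow> 'a"
  assumes q_nonzero: "q \<noteq> 0"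
    and q_not_root_of_unity: "\<And>n::nat. n > 0 \<Longrightarrow> q ^ n \<noteq> 1"
    and presentation: "has_presentation scale X (alt_relators q)"
begin

sublocale unital_algebra scale
  using presentation by (simp add: has_presentation_def)

abbreviation "q' \<equiv> inverse q"
abbreviation "k \<equiv> q + q'"
abbreviation "\<rho> \<equiv> - ((k * (q - q'))\<^sup>2)"
abbreviation "Wm i \<equiv> X (Wminus i)"
abbreviation "Wp i \<equiv> X (Wplus i)"
abbreviation "G i \<equiv> X (Gpl i)"
abbreviation "Gt i \<equiv> X (Gti i)"

lemma q_square_diff: "q ^ 2 - q powi (-2) = k * (q - q')"
  by (simp add: algebra_simps power2_eq_square power_int_minus)

lemma k_nonzero: "k \<noteq> 0"
proof
  assume "k = 0"
  then have "q * q = - 1"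
    using q_nonzero by (simp add: field_simps eq_neg_iff_add_eq_0)
  then have "q ^ 4 = 1" by (simp add: power4_eq_xxxx)
  then show False using q_not_root_of_unity[of 4] by simp
qed

lemma q_diff_nonzero: "q - q' \<noteq> 0"
proof
  assume "q - q' = 0"
  then have "q\<^sup>2 = 1" using q_nonzero by (simp add: field_simps power2_eq_square)
  then show False using q_not_root_of_unity[of 2] by simp
qed

lemma free_eval_alt_relator: "r \<in> alt_relators q \<Longrightarrow> free_eval scale X r = 0"
  by (rule has_presentation_relator[OF presentation])

lemma
  shows comm_Wm0_Wp: "comm (Wm 0) (Wp i) = scale (inverse k) (Gt i - G i)"
    and comm_Wm_Wp0: "comm (Wm i) (Wp 0) = scale (inverse k) (Gt i - G i)"
    and qcomm_Wm0_G: "qcomm scale q (Wm 0) (G i) = scale \<rho> (Wm (Suc i) - Wp i)"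
    and qcomm_Gt_Wm0: "qcomm scale q (Gt i) (Wm 0) = scale \<rho> (Wm (Suc i) - Wp i)"
    and qcomm_G_Wp0: "qcomm scale q (G i) (Wp 0) = scale \<rho> (Wp (Suc i) - Wm i)"
    and qcomm_Wp0_Gt: "qcomm scale q (Wp 0) (Gt i) = scale \<rho> (Wp (Suc i) - Wm i)"
    and comm_Wm: "comm (Wm i) (Wm j) = 0"
    and comm_Wp: "comm (Wp i) (Wp j) = 0"
proof -
  let ?R = "{comm (free_gen (Wminus 0)) (free_gen (Wplus i))
        - free_scale (inverse (q + inverse q)) (free_gen (Gti i) - free_gen (Gpl i)),
      comm (free_gen (Wminus i)) (free_gen (Wplus 0))
        - free_scale (inverse (q + inverse q)) (free_gen (Gti i) - free_gen (Gpl i)),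
      qcomm free_scale q (free_gen (Wminus 0)) (free_gen (Gpl i))
        - (free_scale \<rho> (free_gen (Wminus (i + 1))) - free_scale \<rho> (free_gen (Wplus i))),
      qcomm free_scale q (free_gen (Gti i)) (free_gen (Wminus 0))
        - (free_scale \<rho> (free_gen (Wminus (i + 1))) - free_scale \<rho> (free_gen (Wplus i))),
      qcomm free_scale q (free_gen (Gpl i)) (free_gen (Wplus 0))
        - (free_scale \<rho> (free_gen (Wplus (i + 1))) - free_scale \<rho> (free_gen (Wminus i))),
      qcomm free_scale q (free_gen (Wplus 0)) (free_gen (Gti i))
        - (free_scale \<rho> (free_gen (Wplus (i + 1))) - free_scale \<rho> (free_gen (Wminus i))),
      comm (free_gen (Wminus i)) (free_gen (Wminus j)),
      comm (free_gen (Wplus i)) (free_gen (Wplus j))}"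
  have "?R \<subseteq> alt_relators q"
    unfolding q_square_diff[symmetric] alt_relators_def Let_def by blast
  then have "\<forall>r\<in>?R. free_eval scale X r = 0"
    using free_eval_alt_relator by blast
  then show "comm (Wm 0) (Wp i) = scale (inverse k) (Gt i - G i)"
    and "comm (Wm i) (Wp 0) = scale (inverse k) (Gt i - G i)"
    and "qcomm scale q (Wm 0) (G i) = scale \<rho> (Wm (Suc i) - Wp i)"
    and "qcomm scale q (Gt i) (Wm 0) = scale \<rho> (Wm (Suc i) - Wp i)"
    and "qcomm scale q (G i) (Wp 0) = scale \<rho> (Wp (Suc i) - Wm i)"
    and "qcomm scale q (Wp 0) (Gt i) = scale \<rho> (Wp (Suc i) - Wm i)"
    and "comm (Wm i) (Wm j) = 0"
    and "comm (Wp i) (Wp j) = 0"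
    by (simp_all add: comm_def qcomm_def free_eval_simps scale_right_diff_distrib)
qed

section \<open>Commutators of \<open>B_delta1\<close> with the alternating generators\<close>

abbreviation "bd \<equiv> B_delta1 scale q (Wm 0) (Wp 0)"

lemma q_bd: "scale q bd = scale q' (Wp 0 * Wm 0) - scale q (Wm 0 * Wp 0)"
  using q_nonzero
  by (simp add: B_delta1_def scale_right_diff_distrib power_int_minus power2_eq_square mult.assoc[symmetric])

text \<open>\<open>Wm i\<close> commutes with \<open>Wm 0\<close>, so only its commutator with
  \<open>Wp 0\<close> enters, which is a multiple of \<open>Gt i - G i\<close>. The q-bracket with
  \<open>G i\<close> equals the one with \<open>Gt i\<close>; this removes \<open>G i\<close> and
  leaves k times the commutator.\<close>

lemma comm_bd_Wm: "scale q (comm bd (Wm i)) = comm (Wm 0) (Gt i)"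
proof -
  have 1: "Wp 0 * Wm 0 * Wm i - Wm i * (Wp 0 * Wm 0) = - (comm (Wm i) (Wp 0) * Wm 0)"
    "Wm 0 * Wp 0 * Wm i - Wm i * (Wm 0 * Wp 0) = - (Wm 0 * comm (Wm i) (Wp 0))"
    using comm_Wm[of 0 i] by (simp_all add: comm_def algebra_simps)
      (metis mult.assoc)+
  have "scale q (comm bd (Wm i)) = scale q bd * Wm i - Wm i * scale q bd"
    by (simp add: comm_def scale_right_diff_distrib scale_mult_left scale_mult_right)
  also have "\<dots> = scale q' (Wp 0 * Wm 0 * Wm i - Wm i * (Wp 0 * Wm 0))
      - scale q (Wm 0 * Wp 0 * Wm i - Wm i * (Wm 0 * Wp 0))"
    unfolding q_bd by (simp add: algebra_simps scale_mult_left scale_mult_right)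
  also have "\<dots> = scale (inverse k) (scale q (Wm 0 * (Gt i - G i)) - scale q' ((Gt i - G i) * Wm 0))"
    unfolding 1 comm_Wm_Wp0
    by (simp add: algebra_simps scale_mult_left scale_mult_right)
  also have "scale q (Wm 0 * (Gt i - G i)) - scale q' ((Gt i - G i) * Wm 0)
      = scale q (Wm 0 * Gt i) - scale q' (Gt i * Wm 0) - qcomm scale q (Wm 0) (G i)"
    by (simp add: qcomm_def algebra_simps)
  also have "\<dots> = scale k (comm (Wm 0) (Gt i))"
    unfolding qcomm_Wm0_G qcomm_Gt_Wm0[symmetric] by (simp add: qcomm_def comm_def algebra_simps)
  finally show ?thesis using k_nonzero by simp
qed

text \<open>The mirrored argument: \<open>Wp i\<close> commutes with \<open>Wp 0\<close>, and the
  q-brackets of \<open>G i\<close> and \<open>Gt i\<close> with \<open>Wp 0\<close> agree.\<close>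

lemma comm_bd_Wp: "scale q (comm bd (Wp i)) = comm (Wp 0) (Gt i)"
proof -
  have 1: "Wp 0 * Wm 0 * Wp i - Wp i * (Wp 0 * Wm 0) = Wp 0 * comm (Wm 0) (Wp i)"
    "Wm 0 * Wp 0 * Wp i - Wp i * (Wm 0 * Wp 0) = comm (Wm 0) (Wp i) * Wp 0"
    using comm_Wp[of 0 i] by (simp_all add: comm_def algebra_simps)
      (metis mult.assoc)+
  have "scale q (comm bd (Wp i)) = scale q bd * Wp i - Wp i * scale q bd"
    by (simp add: comm_def scale_right_diff_distrib scale_mult_left scale_mult_right)
  also have "\<dots> = scale q' (Wp 0 * Wm 0 * Wp i - Wp i * (Wp 0 * Wm 0))
      - scale q (Wm 0 * Wp 0 * Wp i - Wp i * (Wm 0 * Wp 0))"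
    unfolding q_bd by (simp add: algebra_simps scale_mult_left scale_mult_right)
  also have "\<dots> = scale (inverse k) (scale q' (Wp 0 * (Gt i - G i)) - scale q ((Gt i - G i) * Wp 0))"
    unfolding 1 comm_Wm0_Wp
    by (simp add: algebra_simps scale_mult_left scale_mult_right)
  also have "scale q' (Wp 0 * (Gt i - G i)) - scale q ((Gt i - G i) * Wp 0)
      = scale q' (Wp 0 * Gt i) - scale q (Gt i * Wp 0) + qcomm scale q (G i) (Wp 0)"
    by (simp add: qcomm_def algebra_simps)
  also have "\<dots> = scale k (comm (Wp 0) (Gt i))"
    unfolding qcomm_G_Wp0 qcomm_Wp0_Gt[symmetric] by (simp add: qcomm_def comm_def algebra_simps)
  finally show ?thesis using k_nonzero by simp
qed

text \<open>Moving \<open>Gt i\<close> past \<open>Wm 0\<close> and \<open>Wp 0\<close> produces the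
  factors q^2 and q^(-2), which cancel. The corrections \<open>V\<close> and \<open>U\<close> add up
  to commutators of generators that vanish or cancel in pairs.\<close>

lemma comm_bd_Gt: "comm bd (Gt i) = 0"
proof -
  define r where "r = \<rho>"
  define V where "V = Wm (Suc i) - Wp i"
  define U where "U = Wp (Suc i) - Wm i"
  have coeffs: "q * q * (q' * q') = 1" "q * q * (q' * r) = q * r" "q' * q' * (q * q) = 1"
      "q' * q' * (q * r) = q' * r" "q' * (q * r) = r" "q * (q' * r) = r" "q * q' = 1" "q' * q = 1"
    using q_nonzero by (simp_all add: field_simps)
  have V: "Wm 0 * Gt i = scale (q * q) (Gt i * Wm 0) - scale (q * r) V"
  proof -
    have "scale (q * q') (Wm 0 * Gt i) = scale q (scale q (Gt i * Wm 0) - scale r V)"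
      unfolding r_def V_def qcomm_Gt_Wm0[symmetric] by (simp add: qcomm_def)
    then show ?thesis by (simp add: coeffs scale_right_diff_distrib)
  qed
  have U: "Wp 0 * Gt i = scale (q' * q') (Gt i * Wp 0) + scale (q' * r) U"
  proof -
    have "scale (q' * q) (Wp 0 * Gt i) = scale q' (scale q' (Gt i * Wp 0) + scale r U)"
      unfolding r_def U_def qcomm_Wp0_Gt[symmetric] by (simp add: qcomm_def)
    then show ?thesis by (simp add: coeffs scale_right_distrib)
  qed
  have "Wp 0 * Wm 0 * Gt i = scale (q * q) (Wp 0 * Gt i * Wm 0) - scale (q * r) (Wp 0 * V)"
    by (simp only: mult.assoc V scale_mult_right right_diff_distrib)
  also have "\<dots> = scale (q * q * (q' * q')) (Gt i * (Wp 0 * Wm 0)) + scale (q * q * (q' * r)) (U * Wm 0)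
      - scale (q * r) (Wp 0 * V)"
    unfolding U by (simp add: distrib_right scale_mult_left scale_right_distrib mult.assoc)
  finally have 1: "Wp 0 * Wm 0 * Gt i - Gt i * (Wp 0 * Wm 0) = scale (q * r) (U * Wm 0 - Wp 0 * V)"
    by (simp add: coeffs scale_right_diff_distrib)
  have "Wm 0 * Wp 0 * Gt i = scale (q' * q') (Wm 0 * Gt i * Wp 0) + scale (q' * r) (Wm 0 * U)"
    by (simp only: mult.assoc U scale_mult_right distrib_left)
  also have "\<dots> = scale (q' * q' * (q * q)) (Gt i * (Wm 0 * Wp 0)) - scale (q' * q' * (q * r)) (V * Wp 0)
      + scale (q' * r) (Wm 0 * U)"
    unfolding V by (simp add: left_diff_distrib scale_mult_left scale_right_diff_distrib mult.assoc)
  finally have 2: "Wm 0 * Wp 0 * Gt i - Gt i * (Wm 0 * Wp 0) = scale (q' * r) (Wm 0 * U - V * Wp 0)"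
    by (simp add: coeffs scale_right_diff_distrib)
  have "scale q (comm bd (Gt i)) = scale q bd * Gt i - Gt i * scale q bd"
    by (simp add: comm_def scale_right_diff_distrib scale_mult_left scale_mult_right)
  also have "\<dots> = scale q' (Wp 0 * Wm 0 * Gt i - Gt i * (Wp 0 * Wm 0))
      - scale q (Wm 0 * Wp 0 * Gt i - Gt i * (Wm 0 * Wp 0))"
    unfolding q_bd by (simp add: algebra_simps scale_mult_left scale_mult_right)
  also have "\<dots> = scale r ((U * Wm 0 - Wp 0 * V) - (Wm 0 * U - V * Wp 0))"
    unfolding 1 2 by (simp only: scale_scale coeffs scale_right_diff_distrib)
  also have "(U * Wm 0 - Wp 0 * V) - (Wm 0 * U - V * Wp 0)
      = comm (Wm (Suc i)) (Wp 0) - comm (Wm 0) (Wp (Suc i)) + (comm (Wm 0) (Wm i) - comm (Wp i) (Wp 0))"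
    by (simp add: U_def V_def comm_def algebra_simps)
  also have "\<dots> = 0"
    unfolding comm_Wm comm_Wp comm_Wm0_Wp comm_Wm_Wp0 by simp
  finally show ?thesis using q_nonzero by simp
qed

end

section \<open>Generating functions of the root vectors\<close>

context unital_algebra
begin

text \<open>The right-hand side records the initial values: the recursion starts as if the term of
  index -1 were \<open>w0\<close>.\<close>

lemma B_alpha1_series:
  fixes q w0 w1
  defines "B \<equiv> Abs_fps (B_alpha1 scale q w0 w1)"
  shows "B - fps_X\<^sup>2 * B + fps_X * (sc (fps_const (B_coeff q)) * comm (fps_const (B_delta1 scale q w0 w1)) B)
    = fps_const w1 + fps_X * fps_const w0"
proof (rule fps_ext)
  fix n
  show "(B - fps_X\<^sup>2 * B + fps_X * (sc (fps_const (B_coeff q)) * comm (fps_const (B_delta1 scale q w0 w1)) B)) $ n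
    = (fps_const w1 + fps_X * fps_const w0) $ n"
  proof (cases n rule: B_alpha1.cases)
    case 1
    then show ?thesis by (simp add: B_def fps_X_power_mult_nth)
  next
    case 2
    then show ?thesis
      by (simp add: scalar_fps_nth scale_mult_left B_def fps_X_power_mult_nth scalar_fps_const_mult_nth fps_comm_const_nth)
  next
    case (3 m)
    then show ?thesis
      by (simp add: B_def fps_X_power_mult_nth scalar_fps_const_mult_nth fps_comm_const_nth)
  qed
qed

text \<open>The sum of products is the Cauchy coefficient of \<open>B * B\<close> at n - 2, whence
  t^2; it is empty for n = 1, and \<open>B_delta\<close> at 0 supplies the constant term.\<close>

lemma B_series_eq:
  fixes q w0 w1
  defines "B \<equiv> Abs_fps (B_alpha1 scale q w0 w1)"
  shows "B_series scale q w0 w1 = sc (fps_const ((inverse q)\<^sup>2 - 1)) * 1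
    + fps_X * (sc (fps_const ((inverse q)\<^sup>2)) * (B * fps_const w0) - fps_const w0 * B)
    + fps_X\<^sup>2 * (sc (fps_const ((inverse q)\<^sup>2 - 1)) * (B * B))"
proof (rule fps_ext)
  fix n
  have q2: "q powi (-2) = (inverse q)\<^sup>2"
    by (simp add: power_int_minus power_inverse)
  have *: "(\<Sum>l<Suc m. B $ l * B $ (m - l)) = (B * B) $ m" for m
    by (simp add: fps_mult_nth lessThan_Suc_atMost atLeast0AtMost)
  show "B_series scale q w0 w1 $ n = (sc (fps_const ((inverse q)\<^sup>2 - 1)) * 1
    + fps_X * (sc (fps_const ((inverse q)\<^sup>2)) * (B * fps_const w0) - fps_const w0 * B)
    + fps_X\<^sup>2 * (sc (fps_const ((inverse q)\<^sup>2 - 1)) * (B * B))) $ n"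
  proof (cases n rule: B_alpha1.cases)
    case (3 m)
    then show ?thesis
      using *[of m] by (simp add: B_series_def B_delta_def q2 B_def fps_X_power_mult_nth
          scalar_fps_const_mult_nth scalar_fps_nth del: sum.lessThan_Suc)
  qed (simp_all add: B_series_def B_delta_def q2 B_def fps_X_power_mult_nth scalar_fps_const_mult_nth
      scalar_fps_nth scale_mult_left)
qed

end

section \<open>Relations as identities of generating functions\<close>

context alternating_extension
begin

lemma G_zero_eq: "G_zero scale q = scale (- ((q - q') * k\<^sup>2)) 1"
proof -
  have "qnum q 2 = k"
    using q_square_diff q_diff_nonzero by (simp add: qnum_def)
  then show ?thesis by (simp add: G_zero_def)
qed

lemma comm_G_zero: "comm x (G_zero scale q) = 0"
  by (simp add: G_zero_eq comm_def scale_mult_left scale_mult_right)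

text \<open>The normalization of \<open>G_zero\<close> gives (q - q') G_0 = \<rho>, which makes the
  q-bracket relations hold for the constant coefficients too.\<close>

lemma G_zero_qcomm:
  "scale q (G_zero scale q * x) - scale q' (x * G_zero scale q) = scale \<rho> x"
  "scale q (x * G_zero scale q) - scale q' (G_zero scale q * x) = scale \<rho> x"
proof -
  define c where "c = - ((q - q') * k\<^sup>2)"
  have "q * c - q' * c = \<rho>"
    by (simp add: c_def algebra_simps power2_eq_square)
  moreover have "G_zero scale q * x = scale c x" "x * G_zero scale q = scale c x"
    by (simp_all only: G_zero_eq c_def scale_mult_left scale_mult_right mult_1_left mult_1_right)
  ultimately show "scale q (G_zero scale q * x) - scale q' (x * G_zero scale q) = scale \<rho> x"
    "scale q (x * G_zero scale q) - scale q' (G_zero scale q * x) = scale \<rho> x"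
    by (simp_all only: scale_scale flip: scale_left_diff_distrib)
qed

abbreviation "WmS \<equiv> Wminus_series X"
abbreviation "WpS \<equiv> Wplus_series X"
abbreviation "GS \<equiv> G_series scale q X"
abbreviation "GtS \<equiv> Gtilde_series scale q X"

lemmas series_defs = Wminus_series_def Wplus_series_def G_series_def Gtilde_series_def

lemma Gtilde_Wm0_series:
  "sc (fps_const q) * (GtS * fps_const (Wm 0)) - sc (fps_const q') * (fps_const (Wm 0) * GtS)
    = sc (fps_const \<rho>) * (WmS - fps_X * WpS)" (is "?L = ?R")
proof (rule fps_ext)
  fix n
  show "?L $ n = ?R $ n"
  proof (cases n)
    case 0
    then show ?thesis
      using G_zero_qcomm by (simp add: series_defs scalar_fps_nth scale_mult_left mult.assoc)
  next
    case (Suc i)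
    then show ?thesis
      using qcomm_Gt_Wm0[of i] by (simp add: series_defs scalar_fps_const_mult_nth qcomm_def)
  qed
qed

lemma Wp0_Gtilde_series:
  "sc (fps_const q) * (fps_const (Wp 0) * GtS) - sc (fps_const q') * (GtS * fps_const (Wp 0))
    = sc (fps_const \<rho>) * (WpS - fps_X * WmS)" (is "?L = ?R")
proof (rule fps_ext)
  fix n
  show "?L $ n = ?R $ n"
  proof (cases n)
    case 0
    then show ?thesis
      using G_zero_qcomm by (simp add: series_defs scalar_fps_nth scale_mult_left mult.assoc)
  next
    case (Suc i)
    then show ?thesis
      using qcomm_Wp0_Gt[of i] by (simp add: series_defs scalar_fps_const_mult_nth qcomm_def)
  qed
qed

text \<open>The factor \<open>fps_X\<close> is needed because \<open>Gt i\<close> is the coefficient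
  of index i + 1; the constant coefficient is a scalar and commutes with everything.\<close>

lemma comm_bd_Wm_series:
  "sc (fps_const q) * (fps_X * comm (fps_const bd) WmS) = comm (fps_const (Wm 0)) GtS"
proof (rule fps_ext)
  fix n
  show "(sc (fps_const q) * (fps_X * comm (fps_const bd) WmS)) $ n = comm (fps_const (Wm 0)) GtS $ n"
    using comm_bd_Wm
    by (cases n) (simp_all add: series_defs scalar_fps_const_mult_nth fps_comm_const_nth comm_G_zero)
qed

lemma comm_bd_Wp_series:
  "sc (fps_const q) * (fps_X * comm (fps_const bd) WpS) = comm (fps_const (Wp 0)) GtS"
proof (rule fps_ext)
  fix n
  show "(sc (fps_const q) * (fps_X * comm (fps_const bd) WpS)) $ n = comm (fps_const (Wp 0)) GtS $ n"
    using comm_bd_Wp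
    by (cases n) (simp_all add: series_defs scalar_fps_const_mult_nth fps_comm_const_nth comm_G_zero)
qed

lemma comm_bd_Gtilde_series: "comm (fps_const bd) GtS = 0"
proof (rule fps_ext)
  fix n
  show "comm (fps_const bd) GtS $ n = 0 $ n"
    using comm_bd_Gt by (cases n) (simp_all add: series_defs fps_comm_const_nth comm_G_zero)
qed

lemma comm_Wm0_Wm_series: "comm (fps_const (Wm 0)) WmS = 0"
  by (rule fps_ext) (simp add: series_defs fps_comm_const_nth comm_Wm)

text \<open>Eliminates \<open>GS\<close> in favour of \<open>GtS\<close>; the two share their
  constant coefficient.\<close>

lemma G_series_eq: "GS = GtS - sc (fps_const k) * (fps_X * comm (fps_const (Wm 0)) WpS)"
proof (rule fps_ext)
  fix n
  show "GS $ n = (GtS - sc (fps_const k) * (fps_X * comm (fps_const (Wm 0)) WpS)) $ n"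
    using k_nonzero
    by (cases n) (simp_all add: series_defs scalar_fps_const_mult_nth fps_comm_const_nth comm_Wm0_Wp)
qed

end

lemma T_fps_equation:
  assumes "q \<noteq> 0"
  shows "fps_shift 1 (T_fps q) * (fps_const q * fps_X\<^sup>2 + fps_const (inverse q)) = fps_const (q + inverse q)"
  using S_fps_equation[of "inverse q"] assms by (simp add: S_fps_inverse add.commute)

lemma T_fps_nth_0: "T_fps q $ 0 = 0"
  by (simp add: T_fps_def)

lemma T_fps_eq_X_mult_shift: "T_fps q = fps_X * fps_shift 1 (T_fps q)"
  using S_fps_eq_X_mult_shift[of "inverse q"] by (simp add: S_fps_inverse)

text \<open>The recursion uses algebra operations only, so the whole calculation can take place in
  the target of the homomorphism.\<close>

lemma algebra_hom_B_delta:
  assumes hom: "algebra_hom scale scale' f"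
  shows "f (B_delta scale q w0 w1 n) = B_delta scale' q (f w0) (f w1) n"
proof -
  interpret f: Vector_Spaces.linear scale scale' f
    using hom by (simp add: algebra_hom_def)
  have [simp]: "f 1 = 1" "f (x * y) = f x * f y" for x y
    using hom by (simp_all add: algebra_hom_def)
  note [simp] = f.add f.diff f.scale f.sum
  have [simp]: "f (B_alpha1 scale q w0 w1 n) = B_alpha1 scale' q (f w0) (f w1) n" for n
    by (induction n rule: B_alpha1.induct) (simp_all add: B_delta1_def comm_def)
  show ?thesis by (simp add: B_delta_def)
qed

section \<open>Evaluation at \<open>S\<close> and \<open>T\<close> and the factorization\<close>

context alternating_extension
begin

abbreviation "ev Y f \<equiv> f oo sc Y"
abbreviation "Bp \<equiv> Abs_fps (B_alpha1 scale q (Wm 0) (Wp 0))"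
abbreviation "c \<equiv> - (inverse k * inverse (q - q'))"

text \<open>The generating-function identities are linear in the series, and the variable enters
  only as the factor \<open>fps_X\<close>; substitution just replaces it by
  \<open>Y\<close>.\<close>

lemma
  assumes Y: "Y $ 0 = 0"
  shows Gtilde_Wm0_ev: "sc (fps_const q) * (ev Y GtS * fps_const (Wm 0))
      - sc (fps_const q') * (fps_const (Wm 0) * ev Y GtS)
      = sc (fps_const \<rho>) * (ev Y WmS - sc Y * ev Y WpS)"
    and Wp0_Gtilde_ev: "sc (fps_const q) * (fps_const (Wp 0) * ev Y GtS)
      - sc (fps_const q') * (ev Y GtS * fps_const (Wp 0))
      = sc (fps_const \<rho>) * (ev Y WpS - sc Y * ev Y WmS)"
    and comm_bd_Wm_ev: "sc (fps_const q * Y) * comm (fps_const bd) (ev Y WmS) = comm (fps_const (Wm 0)) (ev Y GtS)"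
    and comm_bd_Wp_ev: "sc (fps_const q * Y) * comm (fps_const bd) (ev Y WpS) = comm (fps_const (Wp 0)) (ev Y GtS)"
    and comm_bd_Gtilde_ev: "comm (fps_const bd) (ev Y GtS) = 0"
    and comm_Wm0_Wm_ev: "comm (fps_const (Wm 0)) (ev Y WmS) = 0"
    and G_ev: "ev Y GS = ev Y GtS - sc (fps_const k * Y) * comm (fps_const (Wm 0)) (ev Y WpS)"
proof -
  note simps = compose_scalar_simps compose_scalar_X[OF Y] scalar_fps_mult mult.assoc
  show "sc (fps_const q) * (ev Y GtS * fps_const (Wm 0)) - sc (fps_const q') * (fps_const (Wm 0) * ev Y GtS)
      = sc (fps_const \<rho>) * (ev Y WmS - sc Y * ev Y WpS)"
    using arg_cong[OF Gtilde_Wm0_series, of "ev Y"] by (simp only: simps)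
  show "sc (fps_const q) * (fps_const (Wp 0) * ev Y GtS) - sc (fps_const q') * (ev Y GtS * fps_const (Wp 0))
      = sc (fps_const \<rho>) * (ev Y WpS - sc Y * ev Y WmS)"
    using arg_cong[OF Wp0_Gtilde_series, of "ev Y"] by (simp only: simps)
  show "sc (fps_const q * Y) * comm (fps_const bd) (ev Y WmS) = comm (fps_const (Wm 0)) (ev Y GtS)"
    using arg_cong[OF comm_bd_Wm_series, of "ev Y"] by (simp only: simps)
  show "sc (fps_const q * Y) * comm (fps_const bd) (ev Y WpS) = comm (fps_const (Wp 0)) (ev Y GtS)"
    using arg_cong[OF comm_bd_Wp_series, of "ev Y"] by (simp only: simps)
  show "comm (fps_const bd) (ev Y GtS) = 0"
    using arg_cong[OF comm_bd_Gtilde_series, of "ev Y"] by (simp only: simps fps_compose_0)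
  show "comm (fps_const (Wm 0)) (ev Y WmS) = 0"
    using arg_cong[OF comm_Wm0_Wm_series, of "ev Y"] by (simp only: simps fps_compose_0)
  show "ev Y GS = ev Y GtS - sc (fps_const k * Y) * comm (fps_const (Wm 0)) (ev Y WpS)"
    using arg_cong[OF G_series_eq, of "ev Y"] by (simp only: simps)
qed

lemma const_identities:
  "fps_const q * fps_const q' = 1"
  "fps_const k = fps_const q + fps_const q'"
  "fps_const (q - q') = fps_const q - fps_const q'"
  "fps_const k * fps_const (inverse k) = 1"
  "fps_const (q - q') * fps_const (inverse (q - q')) = 1"
  "fps_const \<rho> = - ((fps_const k * fps_const (q - q'))\<^sup>2)"
  "fps_const c = - (fps_const (inverse k) * fps_const (inverse (q - q')))"
  using q_nonzero k_nonzero q_diff_nonzero by simp_all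

text \<open>Matches the coefficient in the abstract recursion with the one in the recursion for
  \<open>Bp\<close>.\<close>

lemma B_coeff_series:
  "sc (fps_const q * (fps_const (inverse (q - q')))\<^sup>2 * fps_const (inverse k) * fps_X) * f
    = fps_X * (sc (fps_const (B_coeff q)) * f)"
proof -
  have "B_coeff q = q * (inverse (q - q'))\<^sup>2 * inverse k"
    unfolding B_coeff_def q_square_diff by (simp add: field_simps power2_eq_square)
  then have "fps_const q * (fps_const (inverse (q - q')))\<^sup>2 * fps_const (inverse k) = fps_const (B_coeff q)"
    by simp
  then show ?thesis
    by (simp only: mult.commute[of _ fps_X] scalar_fps_mult scalar_fps_X mult.assoc)
qed

lemma comm_mult_right: "comm x (y * z) = comm x y * z + y * comm x z"
  by (simp add: comm_def algebra_simps)

text \<open>Both sides solve one recursion with the same right-hand side \<open>?R\<close>, so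
  uniqueness applies.\<close>

lemma Bp_mult_Gtilde:
  "sc (fps_shift 1 (T_fps q)) * (sc (fps_const q') * ev (T_fps q) WpS - sc (fps_const q * fps_X) * ev (T_fps q) WmS)
    = sc (fps_const c) * (Bp * ev (T_fps q) GtS)" (is "?E = ?H")
proof (rule fps_recursion_unique)
  let ?R = "sc (fps_const c) * ((fps_const (Wp 0) + fps_X * fps_const (Wm 0)) * ev (T_fps q) GtS)"
  note T0 = T_fps_nth_0[of q]
  show "?E - fps_X\<^sup>2 * ?E + fps_X * (sc (fps_const (B_coeff q)) * comm (fps_const bd) ?E) = ?R"
    using fps.alternating_recursion_T[OF const_identities(1-3) T_fps_eq_X_mult_shift
        T_fps_equation[OF q_nonzero] const_identities(4-6) Gtilde_Wm0_ev[OF T0] Wp0_Gtilde_ev[OF T0]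
        comm_bd_Wm_ev[OF T0] comm_bd_Wp_ev[OF T0] refl]
    unfolding B_coeff_series const_identities(7)[symmetric]
    by (simp only: scalar_fps_power scalar_fps_X)
  \<comment> \<open>The commutator with \<open>bd\<close> is a derivation that kills the evaluated
    \<open>GtS\<close>, so the equation for \<open>Bp\<close> may be multiplied by that factor on
    the right.\<close>
  have "?H - fps_X\<^sup>2 * ?H + fps_X * (sc (fps_const (B_coeff q)) * comm (fps_const bd) ?H)
    = sc (fps_const c) * ((Bp - fps_X\<^sup>2 * Bp
        + fps_X * (sc (fps_const (B_coeff q)) * comm (fps_const bd) Bp)) * ev (T_fps q) GtS)"
    unfolding fps.comm_scale_right comm_mult_right[of _ Bp] comm_bd_Gtilde_ev[OF T0] scalar_fps_X[symmetric]
      scalar_fps_power[symmetric]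
    by (simp only: left_diff_distrib right_diff_distrib distrib_left distrib_right mult.assoc
        fps.scale_left_commute mult_zero_right add_0_right)
  then show "?H - fps_X\<^sup>2 * ?H + fps_X * (sc (fps_const (B_coeff q)) * comm (fps_const bd) ?H) = ?R"
    unfolding B_alpha1_series .
qed

text \<open>The same uniqueness argument, with the recursion for \<open>S\<close> and multiplication
  on the left.\<close>

lemma Gtilde_mult_Bp:
  "sc (fps_shift 1 (S_fps q)) * (sc (fps_const q) * ev (S_fps q) WpS - sc (fps_const q' * fps_X) * ev (S_fps q) WmS)
    = sc (fps_const c) * (ev (S_fps q) GtS * Bp)" (is "?E = ?H")
proof (rule fps_recursion_unique)
  let ?R = "sc (fps_const c) * (ev (S_fps q) GtS * (fps_const (Wp 0) + fps_X * fps_const (Wm 0)))"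
  note S0 = S_fps_nth_0[of q]
  show "?E - fps_X\<^sup>2 * ?E + fps_X * (sc (fps_const (B_coeff q)) * comm (fps_const bd) ?E) = ?R"
    using fps.alternating_recursion_S[OF const_identities(1-3) S_fps_eq_X_mult_shift
        S_fps_equation[OF q_nonzero] const_identities(4-6) Gtilde_Wm0_ev[OF S0] Wp0_Gtilde_ev[OF S0]
        comm_bd_Wm_ev[OF S0] comm_bd_Wp_ev[OF S0] refl]
    unfolding B_coeff_series const_identities(7)[symmetric]
    by (simp only: scalar_fps_power scalar_fps_X)
  have "?H - fps_X\<^sup>2 * ?H + fps_X * (sc (fps_const (B_coeff q)) * comm (fps_const bd) ?H)
    = sc (fps_const c) * (ev (S_fps q) GtS * (Bp - fps_X\<^sup>2 * Bp
        + fps_X * (sc (fps_const (B_coeff q)) * comm (fps_const bd) Bp)))"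
    unfolding fps.comm_scale_right comm_mult_right[of _ "ev (S_fps q) GtS"] comm_bd_Gtilde_ev[OF S0] scalar_fps_X[symmetric]
      scalar_fps_power[symmetric]
    by (simp only: left_diff_distrib right_diff_distrib distrib_left distrib_right
        fps.scale_mult_right[of "ev (S_fps q) GtS"] fps.scale_left_commute mult_zero_left add_0_left)
  then show "?H - fps_X\<^sup>2 * ?H + fps_X * (sc (fps_const (B_coeff q)) * comm (fps_const bd) ?H) = ?R"
    unfolding B_alpha1_series .
qed

lemma Z_vee_factorization:
  "Z_vee scale q X = sc (fps_const (- q * (q - q') * (k * (q - q')) powi (-4)))
    * ev (S_fps q) GtS * B_series scale q (Wm 0) (Wp 0) * ev (T_fps q) GtS"
proof -
  note T0 = T_fps_nth_0[of q] and S0 = S_fps_nth_0[of q]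
  let ?i = "inverse k" and ?a = "q - q'"
  have c0: "fps_const (q'\<^sup>2 - 1) = (fps_const q')\<^sup>2 - 1" "fps_const (q'\<^sup>2) = (fps_const q')\<^sup>2"
    by (simp_all flip: fps_const_sub)
  have B: "B_series scale q (Wm 0) (Wp 0) = sc ((fps_const q')\<^sup>2 - 1) * 1
      + sc fps_X * (sc ((fps_const q')\<^sup>2) * (Bp * fps_const (Wm 0)) - fps_const (Wm 0) * Bp)
      + sc (((fps_const q')\<^sup>2 - 1) * fps_X\<^sup>2) * (Bp * Bp)"
    unfolding B_series_eq c0 mult.commute[of _ "fps_X\<^sup>2"] scalar_fps_mult scalar_fps_power scalar_fps_X
    by (simp only: mult.assoc)
  note core = fps.factorization_core[OF const_identities S_fps_eq_X_mult_shift
      S_fps_equation[OF q_nonzero] T_fps_eq_X_mult_shift Gtilde_Wm0_ev[OF S0] comm_Wm0_Wm_ev[OF S0]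
      G_ev[OF S0] Bp_mult_Gtilde Gtilde_mult_Bp B]
  have "qnum q 2 = k"
    using q_square_diff q_diff_nonzero by (simp add: qnum_def)
  then have c1: "fps_const ((qnum q 2) powi (-2)) = (fps_const ?i)\<^sup>2"
    by (simp add: power_int_minus power_inverse)
  have c2: "fps_const ((q ^ 2 - q powi (-2)) powi (-2)) = (fps_const ?i * fps_const (inverse ?a))\<^sup>2"
    unfolding q_square_diff by (simp add: power_int_minus power_inverse power_mult_distrib mult.commute)
  have c3: "fps_const (- q * ?a * (k * ?a) powi (-4))
      = - fps_const q * fps_const ?a * (fps_const ?i * fps_const (inverse ?a)) ^ 4"
    by (simp add: power_int_minus power_inverse power_mult_distrib mult_ac)
  \<comment> \<open>The factor 1/t is absorbed by \<open>S\<close> alone, in accordance with the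
    product \<sigma> T of the abstract identity.\<close>
  have c4: "fps_shift 1 (S_fps q * T_fps q) = fps_shift 1 (S_fps q) * T_fps q"
    by (subst S_fps_eq_X_mult_shift) (intro fps_ext, simp add: mult.assoc)
  have c5: "fps_const (q ^ 2) = (fps_const q)\<^sup>2" "fps_const (q powi (-2)) = (fps_const q')\<^sup>2"
    by (simp_all add: power_int_minus power_inverse)
  show ?thesis
    using core unfolding Z_vee_def Psi_def Let_def c1 c2 c3 c4 c5 by (simp only: mult.assoc)
qed

end

theorem theorem10p1:
  fixes q :: "'f::field"
    and scale_O :: "'f \<Rightarrow> 'a::ring_1 \<Rightarrow> 'a" and W :: "onsager_gen \<Rightarrow> 'a"
    and scale_A :: "'f \<Rightarrow> 'b::ring_1 \<Rightarrow> 'b" and X :: "alt_gen \<Rightarrow> 'b"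
    and \<iota> :: "'a \<Rightarrow> 'b" and \<xi> :: 'f
  assumes q_nonzero: "q \<noteq> 0"
    and q_not_root_of_unity: "\<And>n::nat. n > 0 \<Longrightarrow> q ^ n \<noteq> 1"
    and q_Onsager_algebra: "has_presentation scale_O W (onsager_relators q)"
    and alternating_extension: "has_presentation scale_A X (alt_relators q)"
    and iota_hom: "algebra_hom scale_O scale_A \<iota>"
    and iota_inj: "inj \<iota>"
    and iota_W0: "\<iota> (W W0) = X (Wminus 0)"
    and iota_W1: "\<iota> (W W1) = X (Wplus 0)"
    and xi: "\<xi> = - q * (q - inverse q) * (q ^ 2 - q powi (-2)) powi (-4)"
  shows "Z_vee scale_A q X =
      scalar_fps scale_A (fps_const \<xi>)
      * (Gtilde_series scale_A q X oo scalar_fps scale_A (S_fps q))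
      * fps_map \<iota> (B_series scale_O q (W W0) (W W1))
      * (Gtilde_series scale_A q X oo scalar_fps scale_A (T_fps q))"
proof -
  interpret alternating_extension scale_A q X
    using q_nonzero q_not_root_of_unity alternating_extension by unfold_locales
  have "fps_map \<iota> (B_series scale_O q (W W0) (W W1)) = B_series scale_A q (X (Wminus 0)) (X (Wplus 0))"
    by (rule fps_ext)
      (simp add: fps_map_def B_series_def algebra_hom_B_delta[OF iota_hom] iota_W0 iota_W1)
  then show ?thesis
    unfolding xi q_square_diff by (simp only: Z_vee_factorization)
qed

end
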